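(* Let $G>0$ and $\rho>0$ be constants, let $z_0,z_1$ be real numbers with $-z_0<z_1$, and let $f:[-z_0,z_1]\to[0,\infty)$ be a (measurable) function. Let $$B=\{(s',\phi',z')\ \text{in cylindrical coordinates}:\ -z_0\le z'\le z_1,\ 0\le s'\le f(z'),\ 0\le\phi'\le 2\pi\}\subset\mathbb{R}^3$$ be the solid of revolution generated by revolving the graph of $f$ about the $z$-axis, with constant mass density $\rho$. For every $z\in[-z_0,z_1]$ and every $\phi\in[0,2\pi]$, the gravitational potential $$U_{\rm G}(\vec r)=-G\int_{B}\frac{\rho\,d^3\vec r\,'}{|\vec r-\vec r\,'|}$$ at the surface point $\vec r$ with cylindrical coordinates $(s,\phi,z)=(f(z),\phi,z)$ is given by $$U_{\rm G}(\vec r)=-2\pi G\rho\int_{-z_0}^{z_1} f(z')\,\mathbf{Y}\big(f(z'),f(z),|z-z'|\big)\,dz',$$ where $\mathbf{Y}$ is the explicit combination of complete elliptic integrals defined in the context.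
   Context: Cylindrical coordinates $(s,\phi,z)$ in $\mathbb{R}^3$: $s\ge0$ is the distance to the $z$-axis, $\phi$ the azimuthal angle, $z$ the axial coordinate. Complete elliptic integrals (argument $\kappa$ is the modulus): $$\mathbf{K}(\kappa)=\int_0^1\frac{dt}{\sqrt{1-t^2}\sqrt{1-\kappa^2t^2}},\qquad \mathbf{E}(\kappa)=\int_0^1\frac{\sqrt{1-\kappa^2t^2}}{\sqrt{1-t^2}}\,dt,$$ $$\mathbf{\Pi}(\nu,\kappa)=\int_0^1\frac{dt}{(1-\nu t^2)\sqrt{1-t^2}\sqrt{1-\kappa^2t^2}}.$$ For $a>0$, $b\ge0$, $d\ge0$, put $R=\sqrt{d^2+(a+b)^2}$, $\kappa=\dfrac{2\sqrt{ab}}{R}$, $\nu=\dfrac{4ab}{(a+b)^2}$, and define $$\mathbf{Y}(a,b,d)=\frac{R}{\pi a}\mathbf{E}(\kappa)+\frac{a^2-b^2}{\pi a R}\mathbf{K}(\kappa)+\frac{d^2(a-b)}{\pi a(a+b)R}\mathbf{\Pi}(\nu,\kappa)-\frac{d}{a}\mathbf{\Theta}(a-b),$$ where $\mathbf{\Theta}$ is the unit step function: $\mathbf{\Theta}(x)=1$ for $x>0$, $\mathbf{\Theta}(x)=0$ for $x<0$, $\mathbf{\Theta}(0)=\tfrac12$. When $a=b$ the terms containing $\mathbf{K}$ and $\mathbf{\Pi}$ (which carry the factor $a-b=0$) are taken to be $0$. The product $a\,\mathbf{Y}(a,b,d)$ is taken to be $0$ when $a=0$. (This $\mathbf{Y}(a,b,d)$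 is the closed form of $\int_0^{\infty}\frac{J_1(ka)J_0(kb)}{k}e^{-kd}\,dk$, with $J_0,J_1$ Bessel functions of the first kind.) *)

theory Defs
  imports "HOL-Analysis.Analysis"
begin

text \<open>
  The arguments of the elliptic integrals are the modulus (not the parameter
  \<open>m = \<kappa>\<^sup>2\<close>) and, for the third kind, the characteristic. The integrands are nonnegative
  in the range used below (\<open>0 \<le> \<nu> < 1\<close>, \<open>0 \<le> \<kappa> < 1\<close>, and \<open>0 \<le> \<kappa> \<le> 1\<close> for the
  second kind), so the possibly improper integrals are Lebesgue integrals; the junk value of
  the division at \<open>t = 1\<close> concerns a null set only.
\<close>

definition ellipticK :: "real \<Rightarrow> real" where
  "ellipticK \<kappa> = (LINT t:{0..1}|lborel. 1 / (sqrt (1 - t\<^sup>2) * sqrt (1 - \<kappa>\<^sup>2 * t\<^sup>2)))"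

definition ellipticE :: "real \<Rightarrow> real" where
  "ellipticE \<kappa> = (LINT t:{0..1}|lborel. sqrt (1 - \<kappa>\<^sup>2 * t\<^sup>2) / sqrt (1 - t\<^sup>2))"

definition ellipticPi :: "real \<Rightarrow> real \<Rightarrow> real" where
  "ellipticPi \<nu> \<kappa> =
     (LINT t:{0..1}|lborel. 1 / ((1 - \<nu> * t\<^sup>2) * sqrt (1 - t\<^sup>2) * sqrt (1 - \<kappa>\<^sup>2 * t\<^sup>2)))"

definition unit_step :: "real \<Rightarrow> real" where
  "unit_step x = (if x > 0 then 1 else if x < 0 then 0 else 1 / 2)"

text \<open>
  Intended for \<open>a > 0\<close>, \<open>b \<ge> 0\<close>, \<open>d \<ge> 0\<close>. For \<open>a = b\<close> the characteristic is \<open>1\<close> (and the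
  modulus is \<open>1\<close> if moreover \<open>d = 0\<close>), so that the integrals of the third (and first) kind
  diverge; the terms carrying the factor \<open>a - b\<close> are then \<open>0\<close> by convention.
  Only the product \<open>a * Y a b d\<close> is used at \<open>a = 0\<close>, where it is \<open>0\<close>.
\<close>

definition Y :: "real \<Rightarrow> real \<Rightarrow> real \<Rightarrow> real" where
  "Y a b d =
     (let R = sqrt (d\<^sup>2 + (a + b)\<^sup>2);
          \<kappa> = 2 * sqrt (a * b) / R;
          \<nu> = 4 * a * b / (a + b)\<^sup>2
      in R / (pi * a) * ellipticE \<kappa>
         + (if a = b then 0
            else (a\<^sup>2 - b\<^sup>2) / (pi * a * R) * ellipticK \<kappa>
                 + d\<^sup>2 * (a - b) / (pi * a * (a + b) * R) * ellipticPi \<nu> \<kappa>)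
         - d / a * unit_step (a - b))"

definition cylindrical :: "real \<Rightarrow> real \<Rightarrow> real \<Rightarrow> real ^ 3" where
  "cylindrical s \<phi> z = vector [s * cos \<phi>, s * sin \<phi>, z]"

definition solid_of_revolution :: "(real \<Rightarrow> real) \<Rightarrow> real \<Rightarrow> real \<Rightarrow> (real ^ 3) set" where
  "solid_of_revolution f z0 z1 =
     {cylindrical s' \<phi>' z' | s' \<phi>' z'.
        - z0 \<le> z' \<and> z' \<le> z1 \<and> 0 \<le> s' \<and> s' \<le> f z' \<and> 0 \<le> \<phi>' \<and> \<phi>' \<le> 2 * pi}"

definition grav_potential :: "real \<Rightarrow> real \<Rightarrow> (real ^ 3) set \<Rightarrow> real ^ 3 \<Rightarrow> real" where
  "grav_potential G \<rho> B r = - G * (LINT r':B|lebesgue. \<rho> / norm (r - r'))"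

end

theory Submission
  imports Defs
begin

text \<open>
  The horizontal slice of the solid at height \<open>z'\<close> is a disc of radius \<open>f z'\<close>, so by Tonelli it
  suffices to compute the potential of a homogeneous disc at a point at distance \<open>b\<close> from its
  axis and height \<open>d > 0\<close> above its plane. With \<open>u\<close> the horizontal displacement from that point, the
  kernel \<open>1 / sqrt (\<bar>u\<bar>\<^sup>2 + d\<^sup>2)\<close> is the divergence of the smooth planar field
  \<open>u / (sqrt (\<bar>u\<bar>\<^sup>2 + d\<^sup>2) + d)\<close>, so the divergence theorem turns the disc integral into an
  integral over the boundary circle. The half-angle substitution splits the latter into the three
  complete elliptic integrals and a Poisson integral, which produces the unit step.
\<close>

section \<open>Integrals over a period, the Poisson integral, and the substitution
  \<open>t = sin x\<close>\<close>

lemma continuous_antiderivative: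
  fixes h :: "real \<Rightarrow> real"
  assumes "continuous_on UNIV h"
  obtains P where "\<And>x. (P has_real_derivative h x) (at x)"
proof -
  have "\<exists>F. \<forall>x::real. -\<infinity> < ereal x \<longrightarrow> ereal x < \<infinity> \<longrightarrow> (F has_vector_derivative h x) (at x)"
    using assms by (intro einterval_antiderivative) (auto simp: continuous_on_eq_continuous_at)
  then show thesis
    using that by (auto simp: has_real_derivative_iff_has_vector_derivative)
qed

lemma has_integral_antiderivative:
  fixes P h :: "real \<Rightarrow> real"
  assumes "\<And>x. (P has_real_derivative h x) (at x)" "a \<le> b"
  shows "(h has_integral (P b - P a)) {a..b}"
  using assms
  by (intro fundamental_theorem_of_calculus)
     (auto simp: has_real_derivative_iff_has_vector_derivative[symmetric] intro: DERIV_subset)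

lemmas integral_antiderivative = integral_unique[OF has_integral_antiderivative]

text \<open>For an antiderivative \<open>P\<close>, the increment
  \<open>P (x + 2 * pi) - P x\<close> has derivative zero by periodicity, so it does not depend on
  where the period starts.\<close>

lemma integral_periodic_shift:
  fixes h :: "real \<Rightarrow> real"
  assumes h: "continuous_on UNIV h" and per: "\<And>x. h (x + 2 * pi) = h x"
  shows "integral {0..2 * pi} (\<lambda>x. h (x + c)) = integral {0..2 * pi} h"
proof -
  obtain P where P: "\<And>x. (P has_real_derivative h x) (at x)"
    using continuous_antiderivative[OF h] by blast
  define Q where "Q x = P (x + 2 * pi) - P x" for x
  have "(Q has_real_derivative 0) (at x)" for x
    unfolding Q_def
    using DERIV_diff[OF DERIV_shift[THEN iffD1, OF P[of "x + 2 * pi"]] P] by (simp add: per)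
  then have "Q x = Q y" for x y
    by (rule DERIV_isconst_all[rule_format, of Q]) 
  then have "Q c = Q 0" .
  moreover have "integral {0..2 * pi} (\<lambda>x. h (x + c)) = P (2 * pi + c) - P (0 + c)"
    by (rule integral_antiderivative[where P = "\<lambda>x. P (x + c)"]) (auto intro: DERIV_shift[THEN iffD1] P)
  moreover have "integral {0..2 * pi} h = P (2 * pi) - P 0"
    by (rule integral_antiderivative[OF P]) auto
  ultimately show ?thesis
    by (simp add: Q_def add.commute)
qed

text \<open>A shift by \<open>c - 2 * pi\<close> turns \<open>c - x\<close> into
  \<open>2 * pi - x\<close>, and this reflection maps the period onto itself.\<close>

lemma integral_periodic_reflect:
  fixes h :: "real \<Rightarrow> real"
  assumes h: "continuous_on UNIV h" and per: "\<And>x. h (x + 2 * pi) = h x"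
  shows "integral {0..2 * pi} (\<lambda>x. h (c - x)) = integral {0..2 * pi} h"
proof -
  have "integral {0..2 * pi} (\<lambda>x. h (c - x)) = integral {0..2 * pi} (\<lambda>x. h (c - (x + (c - 2 * pi))))"
    using per[of "c - x - 2 * pi" for x]
    by (intro integral_periodic_shift[symmetric])
       (auto intro!: continuous_intros continuous_on_compose2[OF h] simp: algebra_simps)
  also have "\<dots> = integral {0..2 * pi} (\<lambda>x. h (2 * pi - x))"
    by simp
  also have "\<dots> = integral {0..2 * pi} h"
  proof -
    obtain P where P: "\<And>x. (P has_real_derivative h x) (at x)"
      using continuous_antiderivative[OF h] by blast
    have "integral {0..2 * pi} (\<lambda>x. h (2 * pi - x)) = - P (2 * pi - 2 * pi) - (- P (2 * pi - 0))"
      by (rule integral_antiderivative[where P = "\<lambda>x. - P (2 * pi - x)"])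
         (auto intro!: derivative_eq_intros DERIV_chain2[OF P])
    moreover have "integral {0..2 * pi} h = P (2 * pi) - P 0"
      by (rule integral_antiderivative[OF P]) auto
    ultimately show ?thesis by simp
  qed
  finally show ?thesis .
qed

text \<open>Brings angular integrals to the range of the elliptic integrals. The integrand is
  symmetric about \<open>pi\<close>, so twice the half from \<open>pi\<close> to
  \<open>2 * pi\<close> suffices. There the substitution \<open>pi + 2 * x\<close> yields another
  factor 2, and the offset \<open>pi\<close> makes the cosine equal to
  \<open>2 * (sin x)\<^sup>2 - 1\<close>.\<close>

lemma integral_cos_half_angle:
  fixes F :: "real \<Rightarrow> real"
  assumes F: "continuous_on {-1..1} F"
  shows "integral {0..2 * pi} (\<lambda>x. F (cos x)) = 4 * integral {0..pi / 2} (\<lambda>x. F (2 * (sin x)\<^sup>2 - 1))"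
proof -
  define h where "h x = F (cos x)" for x
  have h: "continuous_on UNIV h"
    unfolding h_def by (intro continuous_on_compose2[OF F] continuous_intros) auto
  obtain P where P: "\<And>x. (P has_real_derivative h x) (at x)"
    using continuous_antiderivative[OF h] by blast
  define Q where "Q x = P x + P (2 * pi - x)" for x
  have "(Q has_real_derivative 0) (at x)" for x
  proof -
    have "(Q has_real_derivative h x + h (2 * pi - x) * (0 - 1)) (at x)"
      unfolding Q_def by (intro DERIV_add P DERIV_chain2[OF P] DERIV_diff DERIV_const DERIV_ident)
    moreover have "h (2 * pi - x) = h x"
      by (simp add: h_def cos_diff)
    ultimately show ?thesis by simp
  qed
  then have "Q x = Q y" for x y
    by (rule DERIV_isconst_all[rule_format, of Q]) 
  then have "Q 0 = Q pi" .
  then have 0: "P 0 + P (2 * pi) = 2 * P pi"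
    by (simp add: Q_def)
  have 1: "integral {0..2 * pi} h = P (2 * pi) - P 0"
    by (rule integral_antiderivative[OF P]) auto
  have eq: "F (2 * (sin x)\<^sup>2 - 1) = h (pi + 2 * x)" for x
    by (simp add: h_def cos_double_sin)
  have "integral {0..pi / 2} (\<lambda>x. F (2 * (sin x)\<^sup>2 - 1)) = P (pi + 2 * (pi / 2)) / 2 - P (pi + 2 * 0) / 2"
    unfolding eq
    by (rule integral_antiderivative[where P = "\<lambda>x. P (pi + 2 * x) / 2"])
       (auto intro!: derivative_eq_intros DERIV_chain2[OF P])
  with 0 1 show ?thesis
    by (simp add: h_def[abs_def])
qed

text \<open>For \<open>a > b\<close> an antiderivative of the integrand is \<open>x - 2 arg (a - b e\<^sup>i\<^sup>x)\<close>.\<close>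

lemma poisson_integral_aux:
  fixes a b :: real
  assumes "0 \<le> b" "b < a"
  shows "integral {0..2 * pi} (\<lambda>x. (a\<^sup>2 - b\<^sup>2) / (a\<^sup>2 + b\<^sup>2 - 2 * a * b * cos x)) = 2 * pi"
proof -
  \<comment> \<open>The real part of \<open>a - b * exp (i * x)\<close> stays positive, so a single
    branch of \<open>arctan\<close> gives its argument over the whole period. The
    \<open>arctan\<close> term vanishes at both ends, and only the increment \<open>2 * pi\<close>
    of the linear term remains.\<close>
  have pos: "0 < a - b * cos x" for x
    using mult_left_mono[OF cos_le_one[of x] assms(1)] assms by linarith
  define P where "P x = x + 2 * arctan (b * sin x / (a - b * cos x))" for x
  have P: "(P has_real_derivative (a\<^sup>2 - b\<^sup>2) / (a\<^sup>2 + b\<^sup>2 - 2 * a * b * cos x)) (at x)" for x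
  proof -
    let ?u = "a - b * cos x"
    have nz: "?u \<noteq> 0" using pos[of x] by simp
    \<comment> \<open>The denominator is the squared modulus of \<open>a - b * exp (i * x)\<close>,
      split into real and imaginary parts.\<close>
    have r: "a\<^sup>2 + b\<^sup>2 - 2 * a * b * cos x = ?u\<^sup>2 + (b * sin x)\<^sup>2"
      by (simp add: power_mult_distrib sin_squared_eq) (simp add: power2_eq_square algebra_simps)
    have rpos: "?u\<^sup>2 + (b * sin x)\<^sup>2 > 0"
      using nz by (simp add: add_pos_nonneg)
    have "(P has_real_derivative 1 + 2 * (inverse (1 + (b * sin x / ?u)\<^sup>2) *
       ((b * cos x * ?u - b * sin x * (b * sin x)) / (?u * ?u)))) (at x)"
      unfolding P_def using nz by (auto intro!: derivative_eq_intros)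
    moreover have "1 + (b * sin x / ?u)\<^sup>2 = (?u\<^sup>2 + (b * sin x)\<^sup>2) / (?u * ?u)"
      using nz by (simp add: power_divide add_divide_distrib power2_eq_square del: right_minus_eq)
    moreover have "1 + 2 * (inverse ((?u\<^sup>2 + (b * sin x)\<^sup>2) / (?u * ?u)) *
       ((b * cos x * ?u - b * sin x * (b * sin x)) / (?u * ?u)))
       = 1 + 2 * (b * cos x * ?u - b * sin x * (b * sin x)) / (?u\<^sup>2 + (b * sin x)\<^sup>2)"
      using nz by simp
    moreover have "\<dots> = (a\<^sup>2 - b\<^sup>2) / (?u\<^sup>2 + (b * sin x)\<^sup>2)"
    proof -
      have "(a - b * c)\<^sup>2 + (b * s)\<^sup>2 + 2 * (b * c * (a - b * c) - b * s * (b * s))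
          = a\<^sup>2 - b\<^sup>2 * (s\<^sup>2 + c\<^sup>2)" for s c :: real
        by (simp add: power2_eq_square algebra_simps)
      from this[of "cos x" "sin x"] show ?thesis using rpos by (simp add: divide_simps)
    qed
    ultimately show ?thesis unfolding r by simp
  qed
  have "integral {0..2 * pi} (\<lambda>x. (a\<^sup>2 - b\<^sup>2) / (a\<^sup>2 + b\<^sup>2 - 2 * a * b * cos x)) = P (2 * pi) - P 0"
    by (rule integral_antiderivative[OF P]) auto
  then show ?thesis by (simp add: P_def)
qed

text \<open>Exchanging \<open>a\<close> and \<open>b\<close> only reverses the sign of the
  numerator. The resulting jump across \<open>a = b\<close> is the source of
  \<open>unit_step\<close> in \<open>Y\<close>.\<close>

lemma poisson_integral:
  fixes a b :: real
  assumes "0 \<le> a" "0 \<le> b" "a \<noteq> b"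
  shows "integral {0..2 * pi} (\<lambda>x. (a\<^sup>2 - b\<^sup>2) / (a\<^sup>2 + b\<^sup>2 - 2 * a * b * cos x)) = 2 * pi * sgn (a - b)"
proof (cases "b < a")
  case True
  then show ?thesis using poisson_integral_aux[of b a] assms by simp
next
  case False
  then have "a < b" using assms by simp
  have "integral {0..2 * pi} (\<lambda>x. (a\<^sup>2 - b\<^sup>2) / (a\<^sup>2 + b\<^sup>2 - 2 * a * b * cos x))
      = integral {0..2 * pi} (\<lambda>x. - ((b\<^sup>2 - a\<^sup>2) / (b\<^sup>2 + a\<^sup>2 - 2 * b * a * cos x)))"
    by (simp add: minus_divide_left add.commute mult.commute mult.left_commute)
  then show ?thesis
    using poisson_integral_aux[of a b] assms \<open>a < b\<close> by simp
qed

text \<open>With \<open>t = sin x\<close> the factor \<open>cos x\<close> of the differential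
  cancels \<open>sqrt (1 - t\<^sup>2)\<close>. Nonnegativity allows the change of variables in the
  extended nonnegative integral, so the singularity at \<open>t = 1\<close> needs no separate
  convergence argument.\<close>

lemma elliptic_substitution:
  fixes h :: "real \<Rightarrow> real"
  assumes h: "continuous_on {0..1} h" and nonneg: "\<And>t. t \<in> {0..1} \<Longrightarrow> 0 \<le> h t"
  shows "(LINT t:{0..1}|lborel. h t / sqrt (1 - t\<^sup>2)) = integral {0..pi / 2} (\<lambda>x. h (sin x))"
proof -
  have Mh: "set_borel_measurable borel {0..1} h"
    by (rule set_measurable_continuous_on[OF _ h]) auto
  have M: "(\<lambda>t. indicator {0..1} t *\<^sub>R (h t / sqrt (1 - t\<^sup>2))) \<in> borel_measurable borel"
    using borel_measurable_times[OF Mh[unfolded set_borel_measurable_def], of "\<lambda>t. 1 / sqrt (1 - t\<^sup>2)"]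
    by simp
  have hs: "continuous_on {0..pi / 2} (\<lambda>x. h (sin x))"
    by (intro continuous_on_compose2[OF h] continuous_intros) (auto intro!: sin_ge_zero)
  have sin01: "sin x \<in> {0..1}" if "x \<in> {0..pi / 2}" for x
    using that by (auto intro!: sin_ge_zero)
  have cpos: "0 \<le> cos x" if "x \<in> {0..pi / 2}" for x
    using that by (auto intro!: cos_ge_zero)
  have "(\<integral>\<^sup>+t. ennreal (indicator {0..1} t *\<^sub>R (h t / sqrt (1 - t\<^sup>2))) \<partial>lborel)
      = (\<integral>\<^sup>+t. ennreal (h t / sqrt (1 - t\<^sup>2)) * indicator {sin 0..sin (pi / 2)} t \<partial>lborel)"
    by (intro nn_integral_cong) (auto split: split_indicator)
  also have "\<dots> = (\<integral>\<^sup>+t. ennreal (h t / sqrt (1 - t\<^sup>2) * indicator {sin 0..sin (pi / 2)} t) \<partial>lborel)"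
    by (intro nn_integral_cong) (auto split: split_indicator)
  also have "\<dots> = (\<integral>\<^sup>+x. ennreal (h (sin x) / sqrt (1 - (sin x)\<^sup>2) * cos x * indicator {0..pi / 2} x) \<partial>lborel)"
    using M by (intro nn_integral_substitution)
      (auto intro!: continuous_intros derivative_eq_intros cpos simp: set_borel_measurable_def)
  also have "\<dots> = (\<integral>\<^sup>+x. ennreal (indicator {0..pi / 2} x *\<^sub>R h (sin x)) \<partial>lborel)"
  proof (intro nn_integral_cong_AE)
    show "AE x in lborel. ennreal (h (sin x) / sqrt (1 - (sin x)\<^sup>2) * cos x * indicator {0..pi / 2} x)
        = ennreal (indicator {0..pi / 2} x *\<^sub>R h (sin x))"
      \<comment> \<open>At \<open>pi / 2\<close> the cancelled factor is zero and the quotient takes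
        its default value, so that point is left out as a null set.\<close>
      using AE_lborel_singleton[of "pi / 2"]
    proof eventually_elim
      case (elim x)
      have "cos x > 0" if "x \<in> {0..pi / 2}"
        using that elim by (intro cos_gt_zero_pi) auto
      moreover have "sqrt (1 - (sin x)\<^sup>2) = \<bar>cos x\<bar>"
        by (simp add: cos_squared_eq[symmetric])
      ultimately show ?case
        by (auto split: split_indicator)
    qed
  qed
  finally have eq: "(\<integral>\<^sup>+t. ennreal (indicator {0..1} t *\<^sub>R (h t / sqrt (1 - t\<^sup>2))) \<partial>lborel)
    = (\<integral>\<^sup>+x. ennreal (indicator {0..pi / 2} x *\<^sub>R h (sin x)) \<partial>lborel)" .
  have Ms: "set_integrable lborel {0..pi / 2} (\<lambda>x. h (sin x))"
    by (rule borel_integrable_atLeastAtMost'[OF hs])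
  have "(LINT t:{0..1}|lborel. h t / sqrt (1 - t\<^sup>2)) = (LINT x:{0..pi / 2}|lborel. h (sin x))"
    unfolding set_lebesgue_integral_def
  proof (subst (1 2) integral_eq_nn_integral)
    show "AE t in lborel. 0 \<le> indicator {0..1} t *\<^sub>R (h t / sqrt (1 - t\<^sup>2))"
      using nonneg by (auto split: split_indicator simp: power_le_one)
    show "AE x in lborel. 0 \<le> indicator {0..pi / 2} x *\<^sub>R h (sin x)"
      using nonneg sin01 by (auto split: split_indicator)
    show "(\<lambda>x. indicator {0..pi / 2} x *\<^sub>R h (sin x)) \<in> borel_measurable lborel"
      using Ms unfolding set_integrable_def by (rule borel_measurable_integrable)
  qed (use M eq in auto)
  also have "\<dots> = integral {0..pi / 2} (\<lambda>x. h (sin x))"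
    by (rule set_borel_integral_eq_integral[OF Ms])
  finally show ?thesis .
qed

section \<open>The divergence theorem on a disc and the boundary form of the disc potential\<close>

lemma mem_disc_iff:
  fixes a :: real
  assumes "0 \<le> a"
  shows "(x, y) \<in> cball (0::real \<times> real) a \<longleftrightarrow> x\<^sup>2 + y\<^sup>2 \<le> a\<^sup>2"
  using assms real_sqrt_le_iff[of "x\<^sup>2 + y\<^sup>2" "a\<^sup>2"] by (simp add: norm_prod_def)

text \<open>This is the divergence theorem for the field \<open>(V, 0)\<close>:
  \<open>a * cos t\<close> is the first component of the outward unit normal times the arc length
  element. Integrating \<open>W\<close> along each horizontal chord leaves the difference of
  \<open>V\<close> at its two ends, and the heights are then parametrized by
  \<open>a * sin t\<close>.\<close>

lemma integral_disc_partial_fst: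
  fixes V W :: "real \<Rightarrow> real \<Rightarrow> real"
  assumes dV: "\<And>x y. ((\<lambda>x. V x y) has_real_derivative W x y) (at x)"
    and cV: "continuous_on UNIV (\<lambda>p. V (fst p) (snd p))"
    and cW: "continuous_on UNIV (\<lambda>p. W (fst p) (snd p))"
    and a: "0 \<le> a"
  shows "(LINT p:cball 0 a|lborel. W (fst p) (snd p))
    = integral {0..2 * pi} (\<lambda>t. V (a * cos t) (a * sin t) * (a * cos t))"
proof -
  have cV': "continuous_on S (\<lambda>x. V (u x) (v x))"
    if "continuous_on S u" "continuous_on S v" for S :: "real set" and u v
    using continuous_on_compose2[OF cV continuous_on_Pair[OF that]] by simp
  have cW': "continuous_on S (\<lambda>x. W (u x) (v x))"
    if "continuous_on S u" "continuous_on S v" for S :: "real set" and u v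
    using continuous_on_compose2[OF cW continuous_on_Pair[OF that]] by simp
  \<comment> \<open>Half the length of the chord at height \<open>y\<close>.\<close>
  define s where "s y = sqrt (a\<^sup>2 - y\<^sup>2)" for y
  define J where "J y = V (s y) y - V (- s y) y" for y
  have int: "integrable (lborel \<Otimes>\<^sub>M lborel) (\<lambda>(x, y). indicator (cball 0 a) (x, y) *\<^sub>R W x y)"
    using borel_integrable_compact[OF compact_cball continuous_on_subset[OF cW], of 0 a]
    by (simp add: lborel_prod case_prod_unfold del: mem_cball_0)
  have inner: "(\<integral>x. indicator (cball 0 a) (x, y) *\<^sub>R W x y \<partial>lborel) = indicator {-a..a} y *\<^sub>R J y" for y
  proof (cases "y \<in> {-a..a}")
    case True
    then have ya: "y\<^sup>2 \<le> a\<^sup>2"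
      using a by (simp add: abs_le_square_iff[symmetric] abs_le_iff)
    then have s: "0 \<le> s y" "(s y)\<^sup>2 = a\<^sup>2 - y\<^sup>2"
      by (simp_all add: s_def)
    have "(x, y) \<in> cball 0 a \<longleftrightarrow> x \<in> {- s y..s y}" for x :: real
    proof -
      have "x\<^sup>2 + y\<^sup>2 \<le> a\<^sup>2 \<longleftrightarrow> \<bar>x\<bar> \<le> \<bar>s y\<bar>"
        unfolding abs_le_square_iff s(2) by linarith
      then show ?thesis unfolding mem_disc_iff[OF a] using s by auto
    qed
    then have "(\<integral>x. indicator (cball 0 a) (x, y) *\<^sub>R W x y \<partial>lborel)
        = (\<integral>x. W x y * indicator {- s y..s y} x \<partial>lborel)"
      by (intro Bochner_Integration.integral_cong) (auto simp: indicator_def)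
    also have "\<dots> = V (s y) y - V (- s y) y"
      using s dV cW'[of UNIV "\<lambda>x. x" "\<lambda>_. y"]
      by (intro integral_FTC_Icc_real) (auto simp: continuous_on_eq_continuous_at)
    finally show ?thesis using True by (simp add: J_def)
  next
    case False
    then have "a\<^sup>2 < y\<^sup>2"
      using a by (metis abs_le_iff abs_le_square_iff abs_of_nonneg atLeastAtMost_iff minus_le_iff not_le)
    then have "(x, y) \<notin> cball 0 a" for x :: real
      unfolding mem_disc_iff[OF a] using zero_le_power2[of x] by linarith
    then show ?thesis using False by simp
  qed
  have cs: "continuous_on {-a..a} s"
    unfolding s_def by (intro continuous_intros)
  have cJ: "continuous_on {-a..a} J"
    unfolding J_def by (intro continuous_intros cV' cs)
  define k where "k t = V (a * cos t) (a * sin t) * (a * cos t)" for t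
  have ck: "continuous_on UNIV k"
    unfolding k_def by (intro continuous_intros cV')
  obtain P where P: "\<And>x. (P has_real_derivative k x) (at x)"
    using continuous_antiderivative[OF ck] by blast
  have "(LINT p:cball 0 a|lborel. W (fst p) (snd p))
      = (\<integral>p. (\<lambda>(x, y). indicator (cball 0 a) (x, y) *\<^sub>R W x y) p \<partial>(lborel \<Otimes>\<^sub>M lborel))"
    unfolding set_lebesgue_integral_def lborel_prod
    by (intro Bochner_Integration.integral_cong) auto
  also have "\<dots> = (\<integral>y. (\<integral>x. indicator (cball 0 a) (x, y) *\<^sub>R W x y \<partial>lborel) \<partial>lborel)"
    by (rule lborel_pair.integral_snd[OF int, symmetric])
  also have "\<dots> = (LINT y:{-a..a}|lborel. J y)"
    unfolding inner set_lebesgue_integral_def ..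
  also have "\<dots> = integral {-a..a} J"
    by (rule set_borel_integral_eq_integral[OF borel_integrable_atLeastAtMost'[OF cJ]])
  also have "\<dots> = integral {- (pi / 2)..pi / 2} (\<lambda>t. (a * cos t) *\<^sub>R J (a * sin t))"
  proof -
    have "((\<lambda>t. (a * cos t) *\<^sub>R J (a * sin t)) has_integral
        integral {a * sin (- (pi / 2))..a * sin (pi / 2)} J) {- (pi / 2)..pi / 2}"
    proof (rule has_integral_substitution[where c = "-a" and d = a])
      show "(\<lambda>x. a * sin x) ` {- (pi / 2)..pi / 2} \<subseteq> {-a..a}"
        using mult_left_mono[OF sin_le_one a] mult_left_mono[OF sin_ge_minus_one a] by auto
    qed (use a cJ in \<open>auto intro!: derivative_eq_intros\<close>)
    then show ?thesis
      using a by (simp add: integral_unique)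
  qed
  \<comment> \<open>The right end of the chord at height \<open>a * sin t\<close> has angle
    \<open>t\<close>, the left end has angle \<open>pi - t\<close>. The sign of the cosine at
    \<open>pi - t\<close> absorbs the minus sign in \<open>J\<close>.\<close>
  also have "\<dots> = integral {- (pi / 2)..pi / 2} (\<lambda>t. k t + k (pi - t))"
  proof (intro integral_cong)
    fix t assume t: "t \<in> {- (pi / 2)..pi / 2}"
    have "s (a * sin t) = sqrt ((a * cos t)\<^sup>2)"
      unfolding s_def by (rule arg_cong[of _ _ sqrt]) (simp add: power_mult_distrib cos_squared_eq algebra_simps)
    also have "\<dots> = a * cos t"
      using t a cos_ge_zero[of t] by simp
    finally show "(a * cos t) *\<^sub>R J (a * sin t) = k t + k (pi - t)"
      by (simp add: J_def k_def algebra_simps cos_diff sin_diff)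
  qed
  also have "\<dots> = (P (pi / 2) - P (pi - pi / 2)) - (P (- (pi / 2)) - P (pi - (- (pi / 2))))"
    by (rule integral_antiderivative[where P = "\<lambda>t. P t - P (pi - t)"])
       (auto intro!: derivative_eq_intros P DERIV_chain2[OF P])
  \<comment> \<open>The right and left semicircles join to one full turn that starts at
    \<open>- (pi / 2)\<close>. Periodicity then moves the start to \<open>0\<close>.\<close>
  also have "\<dots> = P (2 * pi + (- (pi / 2))) - P (0 + (- (pi / 2)))"
    by (simp add: field_simps)
  also have "\<dots> = integral {0..2 * pi} (\<lambda>t. k (t + (- (pi / 2))))"
    by (rule integral_antiderivative[symmetric, OF DERIV_shift[THEN iffD1, OF P]]) simp
  also have "\<dots> = integral {0..2 * pi} k"
    by (rule integral_periodic_shift[OF ck]) (simp add: k_def)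
  finally show ?thesis by (simp add: k_def[abs_def])
qed

text \<open>The disc is invariant under exchanging the coordinates, which reduces this to the first
  partial derivative. The exchange swaps sine and cosine on the circle, and the reflection
  \<open>pi / 2 - t\<close> swaps them back.\<close>

lemma integral_disc_partial_snd:
  fixes V W :: "real \<Rightarrow> real \<Rightarrow> real"
  assumes dV: "\<And>x y. ((\<lambda>y. V x y) has_real_derivative W x y) (at y)"
    and cV: "continuous_on UNIV (\<lambda>p. V (fst p) (snd p))"
    and cW: "continuous_on UNIV (\<lambda>p. W (fst p) (snd p))"
    and a: "0 \<le> a"
  shows "(LINT p:cball 0 a|lborel. W (fst p) (snd p))
    = integral {0..2 * pi} (\<lambda>t. V (a * cos t) (a * sin t) * (a * sin t))"
proof -
  have swap: "continuous_on UNIV (\<lambda>p. u (snd p) (fst p))"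
    if "continuous_on UNIV (\<lambda>p. u (fst p) (snd p))" for u :: "real \<Rightarrow> real \<Rightarrow> real"
    using continuous_on_compose2[OF that continuous_on_Pair[OF continuous_on_snd continuous_on_fst],
        OF continuous_on_id continuous_on_id]
    by simp
  define k where "k t = V (a * cos t) (a * sin t) * (a * sin t)" for t
  have ck: "continuous_on UNIV k"
  proof -
    have "continuous_on UNIV (\<lambda>t. (a * cos t, a * sin t))"
      by (intro continuous_intros)
    from continuous_on_compose2[OF cV this]
    have "continuous_on UNIV (\<lambda>t. V (a * cos t) (a * sin t))"
      by simp
    then show ?thesis
      unfolding k_def by (intro continuous_intros)
  qed
  have int: "integrable (lborel \<Otimes>\<^sub>M lborel) (\<lambda>p. indicator (cball 0 a) p *\<^sub>R W (fst p) (snd p))"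
    using borel_integrable_compact[OF compact_cball continuous_on_subset[OF cW], of 0 a]
    by (simp add: lborel_prod)
  have "(LINT p:cball 0 a|lborel. W (fst p) (snd p))
      = (\<integral>p. indicator (cball 0 a) p *\<^sub>R W (fst p) (snd p) \<partial>(lborel \<Otimes>\<^sub>M lborel))"
    by (simp add: set_lebesgue_integral_def lborel_prod)
  also have "\<dots> = (\<integral>(x, y). indicator (cball 0 a) (y, x) *\<^sub>R W y x \<partial>(lborel \<Otimes>\<^sub>M lborel))"
    using lborel_pair.integral_product_swap[OF borel_measurable_integrable[OF int]] by simp
  also have "\<dots> = (LINT p:cball 0 a|lborel. W (snd p) (fst p))"
    unfolding set_lebesgue_integral_def lborel_prod
    by (intro Bochner_Integration.integral_cong)
       (auto simp: indicator_def norm_prod_def add.commute)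
  also have "\<dots> = integral {0..2 * pi} (\<lambda>t. V (a * sin t) (a * cos t) * (a * cos t))"
    by (rule integral_disc_partial_fst) (use assms swap in auto)
  also have "\<dots> = integral {0..2 * pi} (\<lambda>t. k (pi / 2 - t))"
    by (simp add: k_def cos_diff sin_diff)
  also have "\<dots> = integral {0..2 * pi} k"
    by (rule integral_periodic_reflect[OF ck]) (simp add: k_def)
  finally show ?thesis by (simp add: k_def[abs_def])
qed

text \<open>Since \<open>d > 0\<close>, the denominator \<open>q + d\<close> of the field never
  vanishes, so no neighbourhood of the projected point has to be cut out, wherever that point lies
  relative to the disc. The angle \<open>\<phi>\<close> only rotates the boundary parametrization
  and drops out by periodicity.\<close>

lemma integral_disc_potential:
  fixes a b d \<phi> :: real
  assumes a: "0 \<le> a" and d: "0 < d"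
  shows "(LINT p:cball 0 a|lborel.
        1 / sqrt ((fst p - b * cos \<phi>)\<^sup>2 + (snd p - b * sin \<phi>)\<^sup>2 + d\<^sup>2))
    = integral {0..2 * pi} (\<lambda>t. a * (a - b * cos t) / (sqrt (a\<^sup>2 + b\<^sup>2 - 2 * a * b * cos t + d\<^sup>2) + d))"
proof -
  define p1 p2 where "p1 = b * cos \<phi>" and "p2 = b * sin \<phi>"
  define q where "q x y = sqrt ((x - p1)\<^sup>2 + (y - p2)\<^sup>2 + d\<^sup>2)" for x y
  have qpos: "q x y > 0" for x y
    using d by (simp add: q_def add_nonneg_pos)
  have qd: "q x y + d \<noteq> 0" for x y
    using qpos[of x y] d by linarith
  have q2: "(q x y)\<^sup>2 = (x - p1)\<^sup>2 + (y - p2)\<^sup>2 + d\<^sup>2" for x y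
    by (simp add: q_def)
  \<comment> \<open>\<open>V1\<close> and \<open>V2\<close> are the components of the field,
    \<open>W1\<close> and \<open>W2\<close> the two summands of its divergence.\<close>
  define V1 W1 V2 W2 where "V1 x y = (x - p1) / (q x y + d)"
    and "W1 x y = 1 / (q x y + d) - (x - p1)\<^sup>2 / (q x y * (q x y + d)\<^sup>2)"
    and "V2 x y = (y - p2) / (q x y + d)"
    and "W2 x y = 1 / (q x y + d) - (y - p2)\<^sup>2 / (q x y * (q x y + d)\<^sup>2)" for x y
  have arg_pos: "0 < (x - p1)\<^sup>2 + (y - p2)\<^sup>2 + d\<^sup>2" for x y
    using d by (simp add: add_nonneg_pos)
  have dq1: "((\<lambda>x. q x y) has_real_derivative (x - p1) / q x y) (at x)" for x y
  proof -
    have "((\<lambda>x. (x - p1)\<^sup>2 + (y - p2)\<^sup>2 + d\<^sup>2) has_real_derivative 2 * (x - p1)) (at x)"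
      by (auto intro!: derivative_eq_intros)
    from DERIV_chain2[OF DERIV_real_sqrt[OF arg_pos] this]
    have "((\<lambda>x. q x y) has_real_derivative inverse (q x y) / 2 * (2 * (x - p1))) (at x)"
      unfolding q_def .
    then show ?thesis
      by (rule DERIV_cong) (use qpos[of x y] in \<open>simp add: field_simps\<close>)
  qed
  have dq2: "((\<lambda>y. q x y) has_real_derivative (y - p2) / q x y) (at y)" for x y
  proof -
    have "((\<lambda>y. (x - p1)\<^sup>2 + (y - p2)\<^sup>2 + d\<^sup>2) has_real_derivative 2 * (y - p2)) (at y)"
      by (auto intro!: derivative_eq_intros)
    from DERIV_chain2[OF DERIV_real_sqrt[OF arg_pos] this]
    have "((\<lambda>y. q x y) has_real_derivative inverse (q x y) / 2 * (2 * (y - p2))) (at y)"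
      unfolding q_def .
    then show ?thesis
      by (rule DERIV_cong) (use qpos[of x y] in \<open>simp add: field_simps\<close>)
  qed
  \<comment> \<open>The left side has the shape that the quotient rule produces for
    \<open>u / (Q + d)\<close>.\<close>
  have quot: "(1 * (Q + d) - u * (u / Q)) / ((Q + d) * (Q + d)) = 1 / (Q + d) - u\<^sup>2 / (Q * (Q + d)\<^sup>2)"
    if "Q > 0" for Q u
    using that d by (simp add: diff_divide_distrib power2_eq_square)
  \<comment> \<open>The product \<open>(Q - d) * (Q + d)\<close> stands for the squared horizontal
    distance, so this identity says that the divergence equals the kernel.\<close>
  have frac: "2 / (Q + d) - (Q - d) * (Q + d) / (Q * (Q + d)\<^sup>2) = 1 / Q" if "Q > 0" for Q
  proof -
    have "(Q - d) * (Q + d) / (Q * (Q + d)\<^sup>2) = (Q - d) / (Q * (Q + d))"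
      using that d by (simp add: power2_eq_square)
    moreover have "2 / (Q + d) - (Q - d) / (Q * (Q + d)) = 1 / Q"
    proof -
      have "2 / (Q + d) - (Q - d) / (Q * (Q + d)) = 2 * Q / (Q * (Q + d)) - (Q - d) / (Q * (Q + d))"
        using that by simp
      also have "\<dots> = (2 * Q - (Q - d)) / (Q * (Q + d))"
        by (rule diff_divide_distrib[symmetric])
      also have "2 * Q - (Q - d) = Q + d"
        by simp
      also have "(Q + d) / (Q * (Q + d)) = 1 / Q"
        using that d by simp
      finally show ?thesis .
    qed
    ultimately show ?thesis by (simp only:)
  qed
  have dV1: "((\<lambda>x. V1 x y) has_real_derivative W1 x y) (at x)" for x y
    unfolding V1_def W1_def quot[OF qpos, symmetric] using qd
    by (auto intro!: derivative_eq_intros dq1)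
  have dV2: "((\<lambda>y. V2 x y) has_real_derivative W2 x y) (at y)" for x y
    unfolding V2_def W2_def quot[OF qpos, symmetric] using qd
    by (auto intro!: derivative_eq_intros dq2)
  have cq: "continuous_on S (\<lambda>p. q (u p) (v p))"
    if "continuous_on S u" "continuous_on S v" for S :: "'a::topological_space set" and u v
    unfolding q_def by (intro continuous_intros that)
  have c: "continuous_on UNIV (\<lambda>p. V1 (fst p) (snd p))" "continuous_on UNIV (\<lambda>p. V2 (fst p) (snd p))"
     "continuous_on UNIV (\<lambda>p. W1 (fst p) (snd p))" "continuous_on UNIV (\<lambda>p. W2 (fst p) (snd p))"
    unfolding V1_def V2_def W1_def W2_def
    by (intro continuous_intros cq; use qd qpos in \<open>auto simp: less_imp_neq[symmetric]\<close>)+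
  have W: "1 / q x y = W1 x y + W2 x y" for x y
  proof -
    have "(q x y - d) * (q x y + d) = (x - p1)\<^sup>2 + (y - p2)\<^sup>2"
      using q2[of x y] by (simp add: power2_eq_square algebra_simps)
    then have "W1 x y + W2 x y = 2 / (q x y + d) - (q x y - d) * (q x y + d) / (q x y * (q x y + d)\<^sup>2)"
      by (simp add: W1_def W2_def add_divide_distrib)
    also have "\<dots> = 1 / q x y"
      by (rule frac[OF qpos])
    finally show ?thesis ..
  qed
  define k where "k t = a * (a - b * cos t) / (sqrt (a\<^sup>2 + b\<^sup>2 - 2 * a * b * cos t + d\<^sup>2) + d)" for t
  have r: "(a * cos t - p1)\<^sup>2 + (a * sin t - p2)\<^sup>2 = a\<^sup>2 + b\<^sup>2 - 2 * a * b * cos (t - \<phi>)" for t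
  proof -
    have "(a * cos t - p1)\<^sup>2 + (a * sin t - p2)\<^sup>2 = a\<^sup>2 * ((sin t)\<^sup>2 + (cos t)\<^sup>2)
       + b\<^sup>2 * ((sin \<phi>)\<^sup>2 + (cos \<phi>)\<^sup>2) - 2 * a * b * (cos t * cos \<phi> + sin t * sin \<phi>)"
      unfolding p1_def p2_def power2_diff power_mult_distrib distrib_left right_diff_distrib
      by (simp only: algebra_simps)
    then show ?thesis by (simp add: cos_diff)
  qed
  have nn: "0 \<le> a\<^sup>2 + b\<^sup>2 - 2 * a * b * cos t" for t
    using r[of "t + \<phi>"] by (metis add_diff_cancel_right' sum_power2_ge_zero)
  have ck: "continuous_on UNIV k"
    unfolding k_def using d nn
    by (intro continuous_intros) (smt (verit) real_sqrt_ge_zero zero_le_power2)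
  have "(LINT p:cball 0 a|lborel. 1 / q (fst p) (snd p))
      = (LINT p:cball 0 a|lborel. W1 (fst p) (snd p)) + (LINT p:cball 0 a|lborel. W2 (fst p) (snd p))"
    unfolding W
    by (rule set_integral_add; unfold set_integrable_def)
       (intro borel_integrable_compact compact_cball continuous_on_subset[OF c(3)]
          continuous_on_subset[OF c(4)] subset_UNIV)+
  also have "\<dots> = integral {0..2 * pi} (\<lambda>t. V1 (a * cos t) (a * sin t) * (a * cos t))
        + integral {0..2 * pi} (\<lambda>t. V2 (a * cos t) (a * sin t) * (a * sin t))"
    using integral_disc_partial_fst[OF dV1 c(1) c(3) a] integral_disc_partial_snd[OF dV2 c(2) c(4) a]
    by simp
  also have "\<dots> = integral {0..2 * pi} (\<lambda>t. V1 (a * cos t) (a * sin t) * (a * cos t)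
      + V2 (a * cos t) (a * sin t) * (a * sin t))"
    unfolding V1_def V2_def
    by (intro Henstock_Kurzweil_Integration.integral_add[symmetric] integrable_continuous_interval
        continuous_intros cq) (use qd in auto)
  \<comment> \<open>The radius vector of the circle times the displacement from the point gives
    \<open>a * (a - b * cos (t - \<phi>))\<close>, the numerator of the outward flux.\<close>
  also have "\<dots> = integral {0..2 * pi} (\<lambda>t. k (t + (- \<phi>)))"
  proof (intro integral_cong)
    fix t
    have "(a * cos t - p1) * (a * cos t) + (a * sin t - p2) * (a * sin t)
       = a * (a * ((sin t)\<^sup>2 + (cos t)\<^sup>2) - b * (cos t * cos \<phi> + sin t * sin \<phi>))"
      unfolding p1_def p2_def power2_eq_square by (simp only: algebra_simps)
    then have "(a * cos t - p1) * (a * cos t) + (a * sin t - p2) * (a * sin t) = a * (a - b * cos (t - \<phi>))"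
      by (simp add: cos_diff)
    then show "V1 (a * cos t) (a * sin t) * (a * cos t) + V2 (a * cos t) (a * sin t) * (a * sin t) = k (t + (- \<phi>))"
      by (simp add: V1_def V2_def k_def q_def r add_divide_distrib[symmetric])
  qed
  also have "\<dots> = integral {0..2 * pi} k"
    by (rule integral_periodic_shift[OF ck]) (simp add: k_def)
  finally show ?thesis by (simp add: k_def[abs_def] q_def p1_def p2_def)
qed

section \<open>Reduction of the boundary integral to complete elliptic integrals\<close>

lemma mult_square_less_1:
  fixes m t :: real
  assumes "m < 1" "t \<in> {0..1}"
  shows "m * t\<^sup>2 < 1"
proof (cases "0 \<le> m")
  case True
  have "m * t\<^sup>2 \<le> m * 1"
    using assms True by (intro mult_left_mono) (auto simp: power_le_one)
  then show ?thesis using assms by simp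
next
  case False
  then have "m * t\<^sup>2 \<le> 0" by (simp add: mult_nonpos_nonneg)
  then show ?thesis by linarith
qed

lemma ellipticE_eq:
  assumes "\<kappa>\<^sup>2 < 1"
  shows "ellipticE \<kappa> = integral {0..pi / 2} (\<lambda>x. sqrt (1 - \<kappa>\<^sup>2 * (sin x)\<^sup>2))"
  unfolding ellipticE_def using mult_square_less_1[OF assms]
  by (intro elliptic_substitution continuous_intros) (auto simp: less_imp_le)

lemma ellipticK_eq:
  assumes "\<kappa>\<^sup>2 < 1"
  shows "ellipticK \<kappa> = integral {0..pi / 2} (\<lambda>x. 1 / sqrt (1 - \<kappa>\<^sup>2 * (sin x)\<^sup>2))"
proof -
  note pos = mult_square_less_1[OF assms]
  have "(LINT t:{0..1}|lborel. 1 / sqrt (1 - \<kappa>\<^sup>2 * t\<^sup>2) / sqrt (1 - t\<^sup>2))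
      = integral {0..pi / 2} (\<lambda>x. 1 / sqrt (1 - \<kappa>\<^sup>2 * (sin x)\<^sup>2))"
  proof (intro elliptic_substitution continuous_intros)
    show "\<forall>x\<in>{0..1}. sqrt (1 - \<kappa>\<^sup>2 * x\<^sup>2) \<noteq> 0"
      using pos by fastforce
    show "0 \<le> 1 / sqrt (1 - \<kappa>\<^sup>2 * t\<^sup>2)" if "t \<in> {0..1}" for t
      using pos[OF that] by simp
  qed
  then show ?thesis
    unfolding ellipticK_def by (simp add: mult.commute)
qed

lemma ellipticPi_eq:
  assumes "\<nu> < 1" "\<kappa>\<^sup>2 < 1"
  shows "ellipticPi \<nu> \<kappa>
    = integral {0..pi / 2} (\<lambda>x. 1 / ((1 - \<nu> * (sin x)\<^sup>2) * sqrt (1 - \<kappa>\<^sup>2 * (sin x)\<^sup>2)))"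
proof -
  note pos = mult_square_less_1[OF assms(1)] mult_square_less_1[OF assms(2)]
  have "(LINT t:{0..1}|lborel. 1 / ((1 - \<nu> * t\<^sup>2) * sqrt (1 - \<kappa>\<^sup>2 * t\<^sup>2)) / sqrt (1 - t\<^sup>2))
      = integral {0..pi / 2} (\<lambda>x. 1 / ((1 - \<nu> * (sin x)\<^sup>2) * sqrt (1 - \<kappa>\<^sup>2 * (sin x)\<^sup>2)))"
  proof (intro elliptic_substitution continuous_intros)
    show "\<forall>x\<in>{0..1}. (1 - \<nu> * x\<^sup>2) * sqrt (1 - \<kappa>\<^sup>2 * x\<^sup>2) \<noteq> 0"
      using pos by fastforce
    show "0 \<le> 1 / ((1 - \<nu> * t\<^sup>2) * sqrt (1 - \<kappa>\<^sup>2 * t\<^sup>2))" if "t \<in> {0..1}" for t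
      using pos(1)[OF that] pos(2)[OF that] by simp
  qed
  then show ?thesis
    unfolding ellipticPi_def by (simp add: mult.commute mult.left_commute)
qed

text \<open>Write \<open>r\<close> for the squared horizontal distance to the boundary point and
  \<open>q\<close> for the full distance, so that \<open>q\<^sup>2 = r + d\<^sup>2\<close>. The
  numerator is \<open>(r + (a\<^sup>2 - b\<^sup>2)) / 2\<close>, and \<open>1 / (q + d)\<close> is
  \<open>(q - d) / r\<close> wherever \<open>r\<close> is nonzero. Splitting \<open>q / r\<close> as
  \<open>1 / q + d\<^sup>2 / (r * q)\<close> then leaves \<open>q\<close>, \<open>1 / q\<close> and
  \<open>1 / (r * q)\<close>, which give the second, first and third kind, next to a constant and a
  Poisson kernel.\<close>

lemma integral_angular_eq_Y:
  fixes a b d :: real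
  assumes a: "0 < a" and b: "0 \<le> b" and d: "0 < d"
  shows "integral {0..2 * pi} (\<lambda>t. a * (a - b * cos t) / (sqrt (a\<^sup>2 + b\<^sup>2 - 2 * a * b * cos t + d\<^sup>2) + d))
    = 2 * pi * (a * Y a b d)"
proof -
  define R \<kappa> \<nu> where "R = sqrt (d\<^sup>2 + (a + b)\<^sup>2)" and "\<kappa> = 2 * sqrt (a * b) / R"
    and "\<nu> = 4 * a * b / (a + b)\<^sup>2"
  define r where "r c = a\<^sup>2 + b\<^sup>2 - 2 * a * b * c" for c
  define q where "q c = sqrt (r c + d\<^sup>2)" for c
  have R: "0 < R" "R\<^sup>2 = d\<^sup>2 + (a + b)\<^sup>2"
    using d by (simp_all add: R_def add_pos_nonneg)
  have ab: "0 \<le> a * b" "0 < a + b" using a b by simp_all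
  have \<kappa>: "\<kappa>\<^sup>2 * R\<^sup>2 = 4 * a * b"
    using R(1) ab by (simp add: \<kappa>_def power_divide power_mult_distrib)
  have "4 * a * b \<le> (a + b)\<^sup>2"
    using zero_le_power2[of "a - b"] by (simp add: power2_eq_square algebra_simps)
  \<comment> \<open>Positivity of \<open>d\<close> makes the modulus strictly less than 1 even for
    \<open>a = b\<close>, so the trigonometric integrands with this modulus are continuous up to
    \<open>pi / 2\<close>.\<close>
  then have "\<kappa>\<^sup>2 * R\<^sup>2 < 1 * R\<^sup>2"
    using \<kappa> R(2) zero_less_power[OF d, of 2] by linarith
  then have \<kappa>1: "\<kappa>\<^sup>2 < 1"
    using R(1) by simp
  have rnn: "0 \<le> r c" if "c \<in> {-1..1}" for c
  proof -
    have "a * b * c \<le> a * b * 1"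
      using that ab by (intro mult_left_mono) auto
    then show ?thesis
      using zero_le_power2[of "a - b"] by (simp add: r_def power2_eq_square algebra_simps)
  qed
  have rpos: "0 < r c" if "c \<in> {-1..1}" "a \<noteq> b" for c
  proof -
    have "a * b * c \<le> a * b * 1"
      using that ab by (intro mult_left_mono) auto
    moreover have "0 < (a - b)\<^sup>2"
      using that by simp
    ultimately show ?thesis
      by (simp add: r_def power2_eq_square algebra_simps)
  qed
  have cos1: "cos t \<in> {-1..1}" for t :: real by simp
  have qpos: "0 < q c" if "c \<in> {-1..1}" for c
    using rnn[OF that] d by (simp add: q_def add_nonneg_pos)
  have q2: "(q c)\<^sup>2 = r c + d\<^sup>2" if "c \<in> {-1..1}" for c
    using rnn[OF that] by (simp add: q_def)
  have rs: "r (2 * (sin x)\<^sup>2 - 1) = (a + b)\<^sup>2 * (1 - \<nu> * (sin x)\<^sup>2)" for x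
  proof -
    have "\<nu> * (a + b)\<^sup>2 = 4 * a * b"
      using ab by (simp add: \<nu>_def)
    then have "(a + b)\<^sup>2 * (1 - \<nu> * (sin x)\<^sup>2) = (a + b)\<^sup>2 - 4 * a * b * (sin x)\<^sup>2"
      by (simp add: algebra_simps)
    then show ?thesis
      by (simp add: r_def power2_eq_square algebra_simps)
  qed
  have qs: "q (2 * (sin x)\<^sup>2 - 1) = R * sqrt (1 - \<kappa>\<^sup>2 * (sin x)\<^sup>2)" for x
  proof -
    have "r (2 * (sin x)\<^sup>2 - 1) + d\<^sup>2 = R\<^sup>2 - 4 * a * b * (sin x)\<^sup>2"
      unfolding R(2) by (simp add: r_def power2_eq_square algebra_simps)
    also have "\<dots> = R\<^sup>2 * (1 - \<kappa>\<^sup>2 * (sin x)\<^sup>2)"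
      unfolding \<kappa>[symmetric] by (simp add: algebra_simps)
    finally show ?thesis
      using R(1) by (simp add: q_def real_sqrt_mult)
  qed
  have cq: "continuous_on {-1..1} q" and cr: "continuous_on {-1..1} r"
    unfolding q_def r_def by (intro continuous_intros)+
  have I1: "integral {0..2 * pi} (\<lambda>t. q (cos t)) = 4 * (R * ellipticE \<kappa>)"
    unfolding integral_cos_half_angle[OF cq] qs ellipticE_eq[OF \<kappa>1] by simp
  have cqt: "continuous_on {0..2 * pi} (\<lambda>t. q (cos t))"
    by (rule continuous_on_compose2[OF cq]) (auto intro!: continuous_intros)
  have int_q: "((\<lambda>t. q (cos t)) has_integral 4 * (R * ellipticE \<kappa>)) {0..2 * pi}"
    unfolding I1[symmetric] by (intro integrable_integral integrable_continuous_interval cqt)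
  have int_d: "((\<lambda>t. d) has_integral 2 * pi * d) {0..2 * pi}"
    using has_integral_const_real[of d 0 "2 * pi"] by simp
  have cancel: "u * v / 2 / v = u / 2" if "0 < v" for u v :: real
    using that by simp
  have step: "1 + sgn (a - b) = 2 * unit_step (a - b)"
    by (simp add: unit_step_def sgn_real_def)
  have lhs: "a * (a - b * c) = (r c + (a\<^sup>2 - b\<^sup>2)) / 2" for c
    by (simp add: r_def power2_eq_square algebra_simps)
  show ?thesis
  proof (cases "a = b")
    \<comment> \<open>Here \<open>r\<close> vanishes where \<open>cos t = 1\<close>, so dividing by
      it is avoided: the numerator is \<open>r / 2\<close>, and its factor \<open>q + d\<close>
      cancels. The remaining constant \<open>d / 2\<close> matches the value \<open>1 / 2\<close> of
      \<open>unit_step\<close> at \<open>0\<close>.\<close>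
    case True
    have "integral {0..2 * pi} (\<lambda>t. a * (a - b * cos t) / (q (cos t) + d))
        = integral {0..2 * pi} (\<lambda>t. q (cos t) / 2 - d / 2)"
    proof (intro integral_cong)
      fix t
      have "r (cos t) = (q (cos t) - d) * (q (cos t) + d)"
        using q2[OF cos1, of t] by (simp add: power2_eq_square algebra_simps)
      then have "a * (a - b * cos t) / (q (cos t) + d) = (q (cos t) - d) * (q (cos t) + d) / 2 / (q (cos t) + d)"
        unfolding lhs by (simp add: True del: divide_divide_eq_left)
      also have "\<dots> = (q (cos t) - d) / 2"
        by (rule cancel) (use qpos[OF cos1, of t] d in simp)
      also have "\<dots> = q (cos t) / 2 - d / 2"
        by (rule diff_divide_distrib)
      finally show "a * (a - b * cos t) / (q (cos t) + d) = q (cos t) / 2 - d / 2" .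
    qed
    also have "\<dots> = 4 * (R * ellipticE \<kappa>) / 2 - 2 * pi * d / 2"
      by (intro integral_unique has_integral_diff has_integral_divide int_q int_d)
    also have "\<dots> = 2 * pi * (a * (R / (pi * a) * ellipticE \<kappa> - d / a * (1 / 2)))"
      using a by (simp add: right_diff_distrib)
    also have "R / (pi * a) * ellipticE \<kappa> - d / a * (1 / 2) = Y a b d"
      unfolding Y_def Let_def R_def[symmetric] \<kappa>_def[symmetric] using True by (simp add: unit_step_def)
    finally show ?thesis
      by (simp add: q_def r_def)
  next
    case False
    then have "\<nu> < 1"
      using ab zero_less_power2[of "a - b"] by (simp add: \<nu>_def power2_eq_square algebra_simps)
    \<comment> \<open>In \<open>alg1\<close> and \<open>alg\<close> the letters \<open>e\<close>,
      \<open>k\<close>, \<open>p\<close> stand for the three elliptic integrals, \<open>m\<close>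
      for \<open>a\<^sup>2 - b\<^sup>2\<close>, \<open>w\<close> for \<open>d\<^sup>2\<close>,
      \<open>n\<close> for \<open>a - b\<close>, \<open>s\<close> for \<open>a + b\<close>,
      \<open>g\<close> for the sign and \<open>u\<close> for the step. The factorization
      \<open>m = s * n\<close> cancels one power of \<open>a + b\<close> in the coefficient of the
      third kind.\<close>
    have alg1: "(1 / 2) * (4 * (R * e) + m * (4 * (k / R)) + m * w * (4 * (p / (s\<^sup>2 * R))) - 2 * pi * d
          - d * (2 * pi * g)) = 2 * R * e + 2 * m / R * k + 2 * w * n / (s * R) * p - pi * d * (1 + g)"
      if "m = s * n" "0 < s" for e m k w n s p g :: real
      using that(2) unfolding that(1) by (simp add: power2_eq_square distrib_left right_diff_distrib mult_ac)
    have alg: "2 * R * e + 2 * m / R * k + 2 * w * n / (s * R) * p - pi * d * (2 * u)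
        = 2 * pi * (a * (R / (pi * a) * e + (m / (pi * a * R) * k + w * n / (pi * a * s * R) * p) - d / a * u))"
      for e m k w n s p u :: real
      using a by (simp add: distrib_left right_diff_distrib)
    have I2: "integral {0..2 * pi} (\<lambda>t. 1 / q (cos t)) = 4 * (ellipticK \<kappa> / R)"
    proof -
      have "continuous_on {-1..1} (\<lambda>c. 1 / q c)"
        by (intro continuous_intros cq) (use qpos in fastforce)
      from integral_cos_half_angle[OF this]
      have "integral {0..2 * pi} (\<lambda>t. 1 / q (cos t))
        = 4 * integral {0..pi / 2} (\<lambda>x. 1 / R * (1 / sqrt (1 - \<kappa>\<^sup>2 * (sin x)\<^sup>2)))"
        unfolding qs by simp
      then show ?thesis
        unfolding ellipticK_eq[OF \<kappa>1] Henstock_Kurzweil_Integration.integral_mult_right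
        by simp
    qed
    have I3: "integral {0..2 * pi} (\<lambda>t. 1 / (r (cos t) * q (cos t))) = 4 * (ellipticPi \<nu> \<kappa> / ((a + b)\<^sup>2 * R))"
    proof -
      have "continuous_on {-1..1} (\<lambda>c. 1 / (r c * q c))"
        by (intro continuous_intros cq cr) (use qpos rpos False in fastforce)
      from integral_cos_half_angle[OF this]
      have "integral {0..2 * pi} (\<lambda>t. 1 / (r (cos t) * q (cos t)))
        = 4 * integral {0..pi / 2} (\<lambda>x. 1 / ((a + b)\<^sup>2 * R) *
            (1 / ((1 - \<nu> * (sin x)\<^sup>2) * sqrt (1 - \<kappa>\<^sup>2 * (sin x)\<^sup>2))))"
        unfolding qs rs by (simp add: mult_ac)
      then show ?thesis
        unfolding ellipticPi_eq[OF \<open>\<nu> < 1\<close> \<kappa>1] Henstock_Kurzweil_Integration.integral_mult_right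
        by simp
    qed
    have I4: "integral {0..2 * pi} (\<lambda>t. (a\<^sup>2 - b\<^sup>2) / r (cos t)) = 2 * pi * sgn (a - b)"
      unfolding r_def by (rule poisson_integral) (use a b False in auto)
    have crt: "continuous_on {0..2 * pi} (\<lambda>t. r (cos t))"
      by (rule continuous_on_compose2[OF cr]) (auto intro!: continuous_intros)
    have nz: "\<forall>t\<in>{0..2 * pi}. r (cos t) \<noteq> 0" "\<forall>t\<in>{0..2 * pi}. q (cos t) \<noteq> 0"
      using rpos[OF cos1 False] qpos[OF cos1] by (auto simp: less_imp_neq[symmetric])
    have int:
      "((\<lambda>t. 1 / q (cos t)) has_integral 4 * (ellipticK \<kappa> / R)) {0..2 * pi}"
      "((\<lambda>t. 1 / (r (cos t) * q (cos t))) has_integral 4 * (ellipticPi \<nu> \<kappa> / ((a + b)\<^sup>2 * R))) {0..2 * pi}"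
      "((\<lambda>t. (a\<^sup>2 - b\<^sup>2) / r (cos t)) has_integral 2 * pi * sgn (a - b)) {0..2 * pi}"
      unfolding I2[symmetric] I3[symmetric] I4[symmetric]
      by (intro integrable_integral integrable_continuous_interval continuous_intros cqt crt;
          use nz in simp)+
    have "((\<lambda>t. (1 / 2) * (q (cos t) + (a\<^sup>2 - b\<^sup>2) * (1 / q (cos t))
          + (a\<^sup>2 - b\<^sup>2) * d\<^sup>2 * (1 / (r (cos t) * q (cos t))) - d - d * ((a\<^sup>2 - b\<^sup>2) / r (cos t))))
        has_integral (1 / 2) * (4 * (R * ellipticE \<kappa>) + (a\<^sup>2 - b\<^sup>2) * (4 * (ellipticK \<kappa> / R))
          + (a\<^sup>2 - b\<^sup>2) * d\<^sup>2 * (4 * (ellipticPi \<nu> \<kappa> / ((a + b)\<^sup>2 * R))) - 2 * pi * d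
          - d * (2 * pi * sgn (a - b)))) {0..2 * pi}"
      by (intro has_integral_mult_right has_integral_add has_integral_diff int int_q int_d)
    moreover have "a * (a - b * cos t) / (q (cos t) + d)
        = (1 / 2) * (q (cos t) + (a\<^sup>2 - b\<^sup>2) * (1 / q (cos t))
          + (a\<^sup>2 - b\<^sup>2) * d\<^sup>2 * (1 / (r (cos t) * q (cos t))) - d - d * ((a\<^sup>2 - b\<^sup>2) / r (cos t)))" for t
    proof -
      define r' q' m where "r' = r (cos t)" and "q' = q (cos t)" and "m = a\<^sup>2 - b\<^sup>2"
      have r': "0 < r'" and q': "0 < q'" and e: "q' * q' = r' + d\<^sup>2"
        using rpos[OF cos1 False] qpos[OF cos1] q2[OF cos1, of t]
        by (simp_all add: r'_def q'_def power2_eq_square)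
      have "1 / q' + d\<^sup>2 * (1 / (r' * q')) = (r' + d\<^sup>2) / (r' * q')"
        using r' q' by (simp add: add_divide_distrib)
      also have "\<dots> = q' / r'"
        unfolding e[symmetric] using q' by simp
      finally have 1: "1 / q' + d\<^sup>2 * (1 / (r' * q')) = q' / r'" .
      have f: "r' = (q' - d) * (q' + d)"
        using e by (simp add: power2_eq_square algebra_simps)
      \<comment> \<open>Numerator and denominator are multiplied by \<open>q' - d\<close>, which is
        nonzero because its product with \<open>q' + d\<close> is the positive number
        \<open>r'\<close>.\<close>
      have "(r' + m) / 2 / (q' + d) = ((r' + m) * (q' - d)) / (2 * ((q' - d) * (q' + d)))"
        using r' d q' f by auto
      also have "\<dots> = (r' + m) * (q' - d) / (2 * r')"
        by (simp only: f[symmetric])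
      also have "\<dots> = (1 / 2) * (q' - d + m * (q' / r') - d * (m / r'))"
        using r' by (simp add: field_simps)
      also have "\<dots> = (1 / 2) * (q' + m * (1 / q') + m * d\<^sup>2 * (1 / (r' * q')) - d - d * (m / r'))"
        unfolding 1[symmetric] by (simp add: algebra_simps)
      finally show ?thesis
        unfolding lhs r'_def q'_def m_def .
    qed
    ultimately have "integral {0..2 * pi} (\<lambda>t. a * (a - b * cos t) / (q (cos t) + d))
        = (1 / 2) * (4 * (R * ellipticE \<kappa>) + (a\<^sup>2 - b\<^sup>2) * (4 * (ellipticK \<kappa> / R))
          + (a\<^sup>2 - b\<^sup>2) * d\<^sup>2 * (4 * (ellipticPi \<nu> \<kappa> / ((a + b)\<^sup>2 * R))) - 2 * pi * d
          - d * (2 * pi * sgn (a - b)))"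
      by (simp only: integral_unique)
    also have "\<dots> = 2 * R * ellipticE \<kappa> + 2 * (a\<^sup>2 - b\<^sup>2) / R * ellipticK \<kappa>
       + 2 * d\<^sup>2 * (a - b) / ((a + b) * R) * ellipticPi \<nu> \<kappa> - pi * d * (1 + sgn (a - b))"
      by (rule alg1) (use ab in \<open>simp_all add: power2_eq_square algebra_simps\<close>)
    also have "\<dots> = 2 * pi * (a * (R / (pi * a) * ellipticE \<kappa>
        + ((a\<^sup>2 - b\<^sup>2) / (pi * a * R) * ellipticK \<kappa>
          + d\<^sup>2 * (a - b) / (pi * a * (a + b) * R) * ellipticPi \<nu> \<kappa>) - d / a * unit_step (a - b)))"
      unfolding step by (rule alg)
    also have "R / (pi * a) * ellipticE \<kappa>
        + ((a\<^sup>2 - b\<^sup>2) / (pi * a * R) * ellipticK \<kappa>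
          + d\<^sup>2 * (a - b) / (pi * a * (a + b) * R) * ellipticPi \<nu> \<kappa>) - d / a * unit_step (a - b) = Y a b d"
      unfolding Y_def Let_def R_def[symmetric] \<kappa>_def[symmetric] \<nu>_def[symmetric] using False by simp
    finally show ?thesis
      by (simp add: q_def r_def)
  qed
qed

lemma integral_disc_potential_eq_Y:
  fixes a b d \<phi> :: real
  assumes "0 \<le> a" "0 \<le> b" "0 < d"
  shows "(LINT p:cball 0 a|lborel.
        1 / sqrt ((fst p - b * cos \<phi>)\<^sup>2 + (snd p - b * sin \<phi>)\<^sup>2 + d\<^sup>2)) = 2 * pi * (a * Y a b d)"
  using integral_disc_potential[of a d b \<phi>] integral_angular_eq_Y[of a b d] assms
  \<comment> \<open>For \<open>a = 0\<close> both sides vanish: the boundary integrand carries the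
    factor \<open>a\<close>, and so does the product with \<open>Y\<close>.\<close>
  by (cases "a = 0") auto

section \<open>Integration over space by horizontal slices, up to null sets\<close>

definition vec3 :: "(real \<times> real) \<times> real \<Rightarrow> real ^ 3" where
  "vec3 p = vector [fst (fst p), snd (fst p), snd p]"

lemma vec3_nth [simp]:
  "vec3 p $ 1 = fst (fst p)" "vec3 p $ 2 = snd (fst p)" "vec3 p $ 3 = snd p"
  by (simp_all add: vec3_def)

lemma measurable_vec3 [measurable]: "vec3 \<in> borel_measurable borel"
proof -
  have "vec3 = (\<lambda>p. fst (fst p) *\<^sub>R axis 1 1 + snd (fst p) *\<^sub>R axis 2 1 + snd p *\<^sub>R axis 3 1)"
    by (rule ext) (simp add: vec_eq_iff forall_3 axis_def)
  also have "\<dots> \<in> borel_measurable borel"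
    by (intro borel_measurable_continuous_onI continuous_intros)
  finally show ?thesis .
qed

lemma prod_Basis_vec3: "(\<Prod>b\<in>(Basis :: (real ^ 3) set). x \<bullet> b) = x $ 1 * x $ 2 * x $ 3"
proof -
  have Basis: "(Basis :: (real ^ 3) set) = (\<lambda>i. axis i 1) ` (UNIV :: 3 set)"
    by (auto simp: Basis_vec_def)
  have inj: "inj (\<lambda>i::3. axis i (1::real))"
    by (auto simp: inj_on_def axis_eq_axis)
  have "(\<Prod>b\<in>(Basis :: (real ^ 3) set). x \<bullet> b) = (\<Prod>i\<in>(UNIV :: 3 set). x \<bullet> axis i 1)"
    unfolding Basis prod.reindex[OF inj] by simp
  also have "\<dots> = (\<Prod>i\<in>(UNIV :: 3 set). x $ i)"
    by (simp add: inner_axis)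
  finally show ?thesis
    unfolding UNIV_3 by (simp add: mult.assoc)
qed

text \<open>Both measures give every box the product of its side lengths, which determines Lebesgue
  measure on Borel sets. The nesting \<open>((x, y), z)\<close> in \<open>vec3\<close> separates the
  horizontal plane from the height, as slicing requires.\<close>

lemma distr_vec3: "distr lborel borel vec3 = lborel"
proof (rule lborel_eqI[symmetric])
  fix l u :: "real ^ 3"
  assume "\<And>b. b \<in> Basis \<Longrightarrow> l \<bullet> b \<le> u \<bullet> b"
  then have le: "l $ i \<le> u $ i" for i
    by (metis axis_in_Basis_iff cart_eq_inner_axis Basis_real_def insertI1)
  have "vec3 -` box l u = box ((l $ 1, l $ 2), l $ 3) ((u $ 1, u $ 2), u $ 3)"
    by (auto simp: mem_box_cart forall_3 box_prod)
  then have "emeasure (distr lborel borel vec3) (box l u)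
      = emeasure lborel (box ((l $ 1, l $ 2), l $ 3) ((u $ 1, u $ 2), u $ 3))"
    by (simp add: emeasure_distr)
  also have "\<dots> = ennreal (\<Prod>b\<in>Basis. (((u $ 1, u $ 2), u $ 3) - ((l $ 1, l $ 2), l $ 3)) \<bullet> b)"
    using le by (intro emeasure_lborel_box) (auto simp: Basis_prod_def)
  also have "(\<Prod>b\<in>Basis. (((u $ 1, u $ 2), u $ 3) - ((l $ 1, l $ 2), l $ 3)) \<bullet> b)
      = (\<Prod>b\<in>Basis. (u - l) \<bullet> b)"
    unfolding prod_Basis_vec3 by (simp add: Basis_prod_def)
  finally show "emeasure (distr lborel borel vec3) (box l u) = ennreal (\<Prod>b\<in>Basis. (u - l) \<bullet> b)" .
qed simp

lemma nn_integral_vec3: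
  assumes [measurable]: "F \<in> borel_measurable borel"
  shows "(\<integral>\<^sup>+v. F v \<partial>lborel) = (\<integral>\<^sup>+z. (\<integral>\<^sup>+w. F (vec3 (w, z)) \<partial>lborel) \<partial>lborel)"
    and "(\<lambda>z. \<integral>\<^sup>+w. F (vec3 (w, z)) \<partial>lborel) \<in> borel_measurable borel"
proof -
  have M: "(\<lambda>p. F (vec3 p)) \<in> borel_measurable (lborel \<Otimes>\<^sub>M lborel)"
    unfolding lborel_prod using measurable_compose[OF measurable_vec3 assms] by simp
  have "(\<integral>\<^sup>+v. F v \<partial>lborel) = (\<integral>\<^sup>+v. F v \<partial>distr lborel borel vec3)"
    by (simp only: distr_vec3)
  also have "\<dots> = (\<integral>\<^sup>+p. F (vec3 p) \<partial>(lborel \<Otimes>\<^sub>M lborel))"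
    unfolding lborel_prod by (rule nn_integral_distr) simp_all
  also have "\<dots> = (\<integral>\<^sup>+z. (\<integral>\<^sup>+w. F (vec3 (w, z)) \<partial>lborel) \<partial>lborel)"
    by (rule lborel_pair.nn_integral_snd[OF M, symmetric])
  finally show "(\<integral>\<^sup>+v. F v \<partial>lborel) = (\<integral>\<^sup>+z. (\<integral>\<^sup>+w. F (vec3 (w, z)) \<partial>lborel) \<partial>lborel)" .
  have "(\<lambda>z. \<integral>\<^sup>+w. F (vec3 (w, z)) \<partial>lborel) \<in> borel_measurable lborel"
    using measurable_compose[OF measurable_pair_swap' M]
    by (intro lborel.borel_measurable_nn_integral) (simp add: case_prod_unfold)
  then show "(\<lambda>z. \<integral>\<^sup>+w. F (vec3 (w, z)) \<partial>lborel) \<in> borel_measurable borel"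
    by simp
qed

text \<open>By Tonelli the set of points whose height lies in a null set is itself null. Hence
  altering the profile \<open>f\<close> at a null set of heights alters the solid only by a null
  set.\<close>

lemma AE_third_coordinate:
  assumes "AE z in lborel. P z"
  shows "AE v in lborel. P ((v :: real ^ 3) $ 3)"
proof -
  obtain N where N: "{z. \<not> P z} \<subseteq> N" "emeasure lborel N = 0" "N \<in> sets borel"
    using AE_E[OF assms] by auto
  note [measurable] = N(3)
  define M where "M = {v :: real ^ 3. v $ 3 \<in> N}"
  have [measurable]: "M \<in> sets borel"
    unfolding M_def by measurable
  have "AE z in lborel. z \<notin> N"
    using N by (intro AE_not_in) (auto simp: null_sets_def)
  then have "(\<integral>\<^sup>+z. (\<integral>\<^sup>+w. indicator M (vec3 (w, z)) \<partial>(lborel :: (real \<times> real) measure)) \<partial>lborel) = (\<integral>\<^sup>+(z::real). 0 \<partial>lborel)"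
    by (intro nn_integral_cong_AE) (auto simp: M_def indicator_def elim!: eventually_mono)
  then have "emeasure lborel M = 0"
    using nn_integral_vec3(1)[of "indicator M"] by simp
  then have "AE v in lborel. v \<notin> M"
    by (intro AE_not_in) (auto simp: null_sets_def)
  then show ?thesis
    by eventually_elim (use N(1) in \<open>auto simp: M_def\<close>)
qed

text \<open>Transfers Borel computations to integrals over \<open>lebesgue\<close>. The equation
  needs no integrability hypothesis: a divergent integral has the default value 0, and
  \<open>enn2real\<close> also sends infinity to 0.\<close>

lemma lebesgue_integral_AE_nn_integral:
  fixes h :: "'a::euclidean_space \<Rightarrow> real"
  assumes h'[measurable]: "h' \<in> borel_measurable borel"
    and ae: "AE x in lborel. 0 \<le> h x \<and> h' x = ennreal (h x)"
  shows "integrable lebesgue h \<longleftrightarrow> (\<integral>\<^sup>+x. h' x \<partial>lborel) < \<infinity>"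
    and "integral\<^sup>L lebesgue h = enn2real (\<integral>\<^sup>+x. h' x \<partial>lborel)"
proof -
  \<comment> \<open>The measure \<open>lebesgue\<close> is complete, so agreement almost everywhere
    with a Borel function suffices for measurability.\<close>
  have [measurable]: "h \<in> borel_measurable lebesgue"
  proof (rule borel_measurable_AE)
    show "(\<lambda>x. enn2real (h' x)) \<in> borel_measurable lebesgue"
      by (intro measurable_completion) measurable
    show "AE x in lebesgue. enn2real (h' x) = h x"
      using AE_completion[OF ae] by eventually_elim simp
  qed
  have nn: "(\<integral>\<^sup>+x. ennreal (h x) \<partial>lebesgue) = (\<integral>\<^sup>+x. h' x \<partial>lborel)"
    unfolding nn_integral_completion
    by (intro nn_integral_cong_AE, use ae in eventually_elim) simp
  have pos: "AE x in lebesgue. 0 \<le> h x"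
    using AE_completion[OF ae] by eventually_elim simp
  have "(\<integral>\<^sup>+x. ennreal (norm (h x)) \<partial>lebesgue) = (\<integral>\<^sup>+x. ennreal (h x) \<partial>lebesgue)"
    by (intro nn_integral_cong_AE, use pos in eventually_elim) simp
  then show "integrable lebesgue h \<longleftrightarrow> (\<integral>\<^sup>+x. h' x \<partial>lborel) < \<infinity>"
    unfolding integrable_iff_bounded nn by simp
  show "integral\<^sup>L lebesgue h = enn2real (\<integral>\<^sup>+x. h' x \<partial>lborel)"
    unfolding nn[symmetric] by (rule integral_eq_nn_integral[OF _ pos]) simp
qed

section \<open>The solid of revolution, its slices and its potential\<close>

lemma solid_of_revolution_iff:
  assumes "\<forall>z\<in>{- z0..z1}. 0 \<le> f z"
  shows "v \<in> solid_of_revolution f z0 z1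
    \<longleftrightarrow> v $ 3 \<in> {- z0..z1} \<and> (v $ 1, v $ 2) \<in> cball 0 (f (v $ 3))"
proof
  assume "v \<in> solid_of_revolution f z0 z1"
  then obtain s t z where v: "v = cylindrical s t z" and z: "z \<in> {- z0..z1}" and s: "0 \<le> s" "s \<le> f z"
    by (auto simp: solid_of_revolution_def)
  have "(s * cos t)\<^sup>2 + (s * sin t)\<^sup>2 = s\<^sup>2 * ((sin t)\<^sup>2 + (cos t)\<^sup>2)"
    by (simp only: power_mult_distrib distrib_left add.commute)
  also have "\<dots> \<le> (f z)\<^sup>2"
    using s by (simp add: power_mono)
  finally show "v $ 3 \<in> {- z0..z1} \<and> (v $ 1, v $ 2) \<in> cball 0 (f (v $ 3))"
    using z s mem_disc_iff[of "f z" "s * cos t" "s * sin t"] by (simp add: v cylindrical_def)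
next
  assume v: "v $ 3 \<in> {- z0..z1} \<and> (v $ 1, v $ 2) \<in> cball 0 (f (v $ 3))"
  define s where "s = sqrt ((v $ 1)\<^sup>2 + (v $ 2)\<^sup>2)"
  have s: "0 \<le> s" "s \<le> f (v $ 3)"
    using v by (simp_all add: s_def norm_prod_def)
  obtain t where t: "0 \<le> t" "t \<le> 2 * pi" "v $ 1 = s * cos t" "v $ 2 = s * sin t"
  \<comment> \<open>On the axis every angle works; elsewhere division by \<open>s\<close> gives a
    point of the unit circle.\<close>
  proof (cases "s = 0")
    case True
    then have "v $ 1 = 0" "v $ 2 = 0"
      by (simp_all add: s_def)
    then show ?thesis using that[of 0] True by simp
  next
    case False
    have "(v $ 1 / s)\<^sup>2 + (v $ 2 / s)\<^sup>2 = ((v $ 1)\<^sup>2 + (v $ 2)\<^sup>2) / s\<^sup>2"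
      by (simp add: power_divide add_divide_distrib)
    also have "\<dots> = 1"
      using False by (simp add: s_def)
    finally obtain t where "0 \<le> t" "t < 2 * pi" "v $ 1 / s = cos t" "v $ 2 / s = sin t"
      by (rule sincos_total_2pi)
    then show ?thesis using that[of t] False by (simp add: field_simps)
  qed
  have "v = cylindrical s t (v $ 3)"
    using t by (simp add: vec_eq_iff forall_3 cylindrical_def)
  then show "v \<in> solid_of_revolution f z0 z1"
    unfolding solid_of_revolution_def using v s t by auto
qed

lemma norm_cylindrical_diff_vec3:
  "norm (cylindrical b \<phi> z - vec3 (w, z'))
    = sqrt ((fst w - b * cos \<phi>)\<^sup>2 + (snd w - b * sin \<phi>)\<^sup>2 + \<bar>z - z'\<bar>\<^sup>2)"
  unfolding norm_vec_def L2_set_def UNIV_3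
  by (simp add: cylindrical_def add.assoc power2_commute[of "b * cos \<phi>"] power2_commute[of "b * sin \<phi>"])

text \<open>Off the plane of the disc the kernel is continuous on it, so the extended integral is
  finite and equals the real one. The sign of \<open>a * Y\<close> is read off from this integral of
  a nonnegative function, not from the elliptic formula.\<close>

lemma nn_integral_disc_potential_eq_Y:
  assumes "0 \<le> a" "0 \<le> b" "z \<noteq> z'" "0 < \<rho>"
  shows "(\<integral>\<^sup>+w. indicator (cball 0 a) w * ennreal (\<rho> / norm (cylindrical b \<phi> z - vec3 (w, z'))) \<partial>lborel)
    = ennreal (2 * pi * \<rho> * (a * Y a b \<bar>z - z'\<bar>))"
    and "0 \<le> a * Y a b \<bar>z - z'\<bar>"
proof -
  define d where "d = \<bar>z - z'\<bar>"
  have d: "0 < d" using assms by (simp add: d_def)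
  define k where "k w = 1 / sqrt ((fst w - b * cos \<phi>)\<^sup>2 + (snd w - b * sin \<phi>)\<^sup>2 + d\<^sup>2)" for w :: "real \<times> real"
  have k0: "0 \<le> k w" for w
    by (simp add: k_def)
  have "0 < (fst w - b * cos \<phi>)\<^sup>2 + (snd w - b * sin \<phi>)\<^sup>2 + d\<^sup>2" for w :: "real \<times> real"
    using d by (simp add: add_nonneg_pos)
  then have "continuous_on (cball 0 a) k"
    unfolding k_def by (intro continuous_intros) (auto simp: less_imp_neq[symmetric])
  then have int: "integrable lborel (\<lambda>w. indicator (cball 0 a) w *\<^sub>R k w)"
    by (intro borel_integrable_compact compact_cball)
  have eq: "(\<integral>w. indicator (cball 0 a) w *\<^sub>R k w \<partial>lborel) = 2 * pi * (a * Y a b d)"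
    using integral_disc_potential_eq_Y[OF assms(1,2) d, of \<phi>]
    by (simp add: set_lebesgue_integral_def k_def)
  have "0 \<le> 2 * pi * (a * Y a b d)"
    unfolding eq[symmetric] using k0 by (intro integral_nonneg_AE) (auto simp: indicator_def)
  then show "0 \<le> a * Y a b \<bar>z - z'\<bar>"
    using zero_le_mult_iff[of "2 * pi"] pi_gt_zero by (simp add: d_def)
  have "(\<integral>\<^sup>+w. indicator (cball 0 a) w * ennreal (\<rho> / norm (cylindrical b \<phi> z - vec3 (w, z'))) \<partial>lborel)
      = (\<integral>\<^sup>+w. ennreal (\<rho> * (indicator (cball 0 a) w *\<^sub>R k w)) \<partial>lborel)"
    unfolding norm_cylindrical_diff_vec3 d_def[symmetric]
    by (intro nn_integral_cong) (simp add: k_def indicator_def)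
  also have "\<dots> = ennreal (\<integral>w. \<rho> * (indicator (cball 0 a) w *\<^sub>R k w) \<partial>lborel)"
    using int k0 assms by (intro nn_integral_eq_integral) (auto simp: indicator_def)
  also have "(\<integral>w. \<rho> * (indicator (cball 0 a) w *\<^sub>R k w) \<partial>lborel) = \<rho> * (2 * pi * (a * Y a b d))"
    by (simp only: integral_mult_right_zero eq)
  finally show "(\<integral>\<^sup>+w. indicator (cball 0 a) w * ennreal (\<rho> / norm (cylindrical b \<phi> z - vec3 (w, z'))) \<partial>lborel)
    = ennreal (2 * pi * \<rho> * (a * Y a b \<bar>z - z'\<bar>))"
    by (simp add: d_def mult_ac)
qed

text \<open>The profile may be unbounded, so the integrals may diverge and take the default value 0.
  The equivalence of integrability ensures that the equation never compares a genuine value with a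
  default one.\<close>

theorem proposition1:
  fixes G \<rho> z0 z1 :: real and f :: "real \<Rightarrow> real"
  assumes "G > 0" and "\<rho> > 0" and "- z0 < z1"
    and "f \<in> borel_measurable (lebesgue_on {- z0..z1})"
    and "\<forall>z\<in>{- z0..z1}. 0 \<le> f z"
  shows "\<forall>z\<in>{- z0..z1}. \<forall>\<phi>\<in>{0..2 * pi}.
           (set_integrable lebesgue (solid_of_revolution f z0 z1)
              (\<lambda>r'. \<rho> / norm (cylindrical (f z) \<phi> z - r'))
            \<longleftrightarrow> set_integrable lebesgue {- z0..z1} (\<lambda>z'. f z' * Y (f z') (f z) \<bar>z - z'\<bar>))
         \<and> grav_potential G \<rho> (solid_of_revolution f z0 z1) (cylindrical (f z) \<phi> z)
           = - 2 * pi * G * \<rho>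
               * (LINT z':{- z0..z1}|lebesgue. f z' * Y (f z') (f z) \<bar>z - z'\<bar>)"
proof (intro ballI)
  fix z \<phi> :: real
  assume z: "z \<in> {- z0..z1}"
  define S where "S = {- z0..z1}"
  define b where "b = f z"
  define B where "B = solid_of_revolution f z0 z1"
  define p where "p = cylindrical b \<phi> z"
  have S[measurable]: "S \<in> sets borel" by (simp add: S_def)
  have b: "0 \<le> b" using z assms(5) by (simp add: b_def)
  have fS: "0 \<le> f x" if "x \<in> S" for x using that assms(5) by (simp add: S_def)
  \<comment> \<open>Because \<open>f\<close> is only Lebesgue measurable, it is replaced almost
    everywhere on \<open>S\<close> by a Borel function \<open>g\<close>. Tonelli is applied to the
    Borel integrand \<open>F\<close> built from \<open>g\<close>.\<close>
  have "(\<lambda>x. if x \<in> S then f x else 0) \<in> borel_measurable lebesgue"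
    using assms(4) by (intro borel_measurable_if_I) (simp_all add: S_def)
  then obtain g0 where g0: "g0 \<in> borel_measurable lborel" "AE x in lborel. (if x \<in> S then f x else 0) = g0 x"
    using completion_ex_borel_measurable_real by blast
  define g where "g x = \<bar>g0 x\<bar>" for x
  have g[measurable]: "g \<in> borel_measurable borel"
    using g0(1) unfolding g_def by simp
  have fg: "AE x in lborel. x \<in> S \<longrightarrow> g x = f x"
    using g0(2)
  proof eventually_elim
    case (elim x)
    then show ?case using fS[of x] by (auto simp: g_def)
  qed
  define F where "F v = indicator {v. v $ 3 \<in> S \<and> (v $ 1)\<^sup>2 + (v $ 2)\<^sup>2 \<le> (g (v $ 3))\<^sup>2} v
    * ennreal (\<rho> / norm (p - v))" for v :: "real ^ 3"
  define I where "I x = (\<integral>\<^sup>+w. F (vec3 (w, x)) \<partial>lborel)" for x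
  have F[measurable]: "F \<in> borel_measurable borel"
    unfolding F_def by measurable
  have I[measurable]: "I \<in> borel_measurable borel"
    unfolding I_def by (rule nn_integral_vec3(2)[OF F])
  have FI: "(\<integral>\<^sup>+v. F v \<partial>lborel) = (\<integral>\<^sup>+x. I x \<partial>lborel)"
    unfolding I_def by (rule nn_integral_vec3(1)[OF F])
  define H where "H v = indicator B v *\<^sub>R (\<rho> / norm (p - v))" for v
  define W where "W x = indicator S x *\<^sub>R (f x * Y (f x) b \<bar>z - x\<bar>)" for x
  have H: "AE v in lborel. 0 \<le> H v \<and> F v = ennreal (H v)"
    using AE_third_coordinate[OF fg]
  proof eventually_elim
    case (elim v)
    have "v \<in> B \<longleftrightarrow> v $ 3 \<in> S \<and> (v $ 1)\<^sup>2 + (v $ 2)\<^sup>2 \<le> (g (v $ 3))\<^sup>2"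
      using elim fS[of "v $ 3"] mem_disc_iff[of "f (v $ 3)" "v $ 1" "v $ 2"]
      unfolding B_def solid_of_revolution_iff[OF assms(5)] S_def[symmetric]
      by (cases "v $ 3 \<in> S") simp_all
    then show ?case
      using assms(2) by (auto simp: H_def F_def indicator_def)
  qed
  have W: "AE x in lborel. 0 \<le> 2 * pi * \<rho> * W x \<and> I x = ennreal (2 * pi * \<rho> * W x)"
    using fg AE_lborel_singleton[of z]
  proof eventually_elim
    case (elim x)
    show ?case
    proof (cases "x \<in> S")
      case True
      note n = nn_integral_disc_potential_eq_Y[OF fS[OF True] b elim(2)[symmetric] assms(2)]
      have "F (vec3 (w, x)) = indicator (cball 0 (f x)) w
          * ennreal (\<rho> / norm (cylindrical b \<phi> z - vec3 (w, x)))" for w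
        using elim True mem_disc_iff[OF fS[OF True], of "fst w" "snd w"]
        by (simp add: F_def p_def indicator_def del: mem_cball_0)
      then show ?thesis
        using n True assms(2) by (simp add: I_def W_def)
    next
      case False
      then show ?thesis by (simp add: I_def F_def W_def)
    qed
  qed
  \<comment> \<open>The space integrand \<open>H\<close> and the axial integrand
    \<open>2 * pi * \<rho> * W\<close> lead to the same extended integral, that of \<open>I\<close>.
    They are therefore integrable together, and their values agree even when that integral is
    infinite.\<close>
  note HI = lebesgue_integral_AE_nn_integral[OF F H, unfolded FI]
  note WI = lebesgue_integral_AE_nn_integral[OF I W]
  have "integrable lebesgue H \<longleftrightarrow> integrable lebesgue W"
    using HI(1) WI(1) assms(2) by simp
  moreover have "integral\<^sup>L lebesgue H = 2 * pi * \<rho> * integral\<^sup>L lebesgue W"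
    using HI(2) WI(2) by simp
  ultimately show "(set_integrable lebesgue (solid_of_revolution f z0 z1)
              (\<lambda>r'. \<rho> / norm (cylindrical (f z) \<phi> z - r'))
            \<longleftrightarrow> set_integrable lebesgue {- z0..z1} (\<lambda>z'. f z' * Y (f z') (f z) \<bar>z - z'\<bar>))
         \<and> grav_potential G \<rho> (solid_of_revolution f z0 z1) (cylindrical (f z) \<phi> z)
           = - 2 * pi * G * \<rho>
               * (LINT z':{- z0..z1}|lebesgue. f z' * Y (f z') (f z) \<bar>z - z'\<bar>)"
    unfolding set_integrable_def set_lebesgue_integral_def grav_potential_def
      H_def[abs_def] W_def[abs_def] B_def p_def b_def S_def
    by simp
qed

end
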